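(* Let $n=2m$ with $m\ge 2$, and for each integer $r\ge 0$ let $H_{D_{2n}}(r)$ be the number of semi-magic squares in $MM(D_{2n})$ with line sum $r$. Then for every integer $r\ge 0$ $$H_{D_{2n}}(r)=\binom{r+4m-1}{2n-1}-2\binom{r+3m-1}{2n-1}+\binom{r+2m-1}{2n-1},$$ and the generating function is $$F_n(x)=\sum_{r\ge 0}H_{D_{2n}}(r)\,x^r=\frac{(1-x^m)^2}{(1-x)^{2n}}.$$
   Context: $D_{2n}$ is the dihedral group with $2n$ elements, realized as the subgroup of the symmetric group $S_n$ generated by the $n$-cycle $R=(1\,2\,\dots\,n)$ and the involution $C$ given by $C(i)=n+1-i$; its elements are $R^k$ and $CR^k$, $0\le k<n$. For $\sigma\in S_n$, $P_\sigma$ is the $n\times n$ permutation matrix with $[P_\sigma]_{ji}=1$ if $\sigma(i)=j$ and $0$ otherwise. $MM(D_{2n})\subseteq M(n,\mathbb{C})$ is the associative algebra over $\mathbb{C}$ generated by the matrices $P_\sigma$, $\sigma\in D_{2n}$ (equivalently, their complex linear span). A semi-magic matrix is a complex $n\times n$ matrix all of whose row sums and column sums are equal; the common value is its line sum. All elements of $MM(D_{2n})$ are semi-magic. A semi-magic square is a semi-magic matrix whose entries are non-negative integers. Binomial coefficients $\binom{a}{b}$ with $0\le a<b$ are $0$. *)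

theory Defs
  imports
    Complex_Main
    "HOL-Computational_Algebra.Formal_Power_Series"
    "HOL-Algebra.Sym_Groups"
    "HOL-Algebra.Generated_Groups"
    "Jordan_Normal_Form.Matrix"
begin

definition rotation :: "nat \<Rightarrow> nat \<Rightarrow> nat" where
  "rotation n = cycle_of_list [1..<n + 1]"

(* Elements of sym_group n are total functions on nat fixing every point outside {1..n}. *)
definition reflection :: "nat \<Rightarrow> nat \<Rightarrow> nat" where
  "reflection n = (\<lambda>i. if i \<in> {1..n} then n + 1 - i else i)"

(* The parameter n is the number of points, so for n \<ge> 3 this set has 2 * n elements. *)
definition dihedral :: "nat \<Rightarrow> (nat \<Rightarrow> nat) set" where
  "dihedral n = generate (sym_group n) {rotation n, reflection n}"

(* Permutations act on {1..n} while matrix indices start at 0: entry (j, i) of the matrix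
   is the classical entry in row j + 1 and column i + 1. *)
definition perm_mat :: "nat \<Rightarrow> (nat \<Rightarrow> nat) \<Rightarrow> complex mat" where
  "perm_mat n \<sigma> = mat n n (\<lambda>(j, i). if \<sigma> (i + 1) = j + 1 then 1 else 0)"

inductive_set generated_algebra :: "nat \<Rightarrow> complex mat set \<Rightarrow> complex mat set"
  for n :: nat and S :: "complex mat set" where
  zero: "0\<^sub>m n n \<in> generated_algebra n S"
| incl: "A \<in> S \<Longrightarrow> A \<in> generated_algebra n S"
| add: "A \<in> generated_algebra n S \<Longrightarrow> B \<in> generated_algebra n S
    \<Longrightarrow> A + B \<in> generated_algebra n S"
| smult: "A \<in> generated_algebra n S \<Longrightarrow> c \<cdot>\<^sub>m A \<in> generated_algebra n S"
| mult: "A \<in> generated_algebra n S \<Longrightarrow> B \<in> generated_algebra n S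
    \<Longrightarrow> A * B \<in> generated_algebra n S"

definition MM :: "nat \<Rightarrow> (nat \<Rightarrow> nat) set \<Rightarrow> complex mat set" where
  "MM n G = generated_algebra n (perm_mat n ` G)"

definition semi_magic :: "nat \<Rightarrow> complex \<Rightarrow> complex mat \<Rightarrow> bool" where
  "semi_magic n s A \<longleftrightarrow> A \<in> carrier_mat n n
     \<and> (\<forall>i<n. (\<Sum>j<n. A $$ (i, j)) = s)
     \<and> (\<forall>j<n. (\<Sum>i<n. A $$ (i, j)) = s)"

definition semi_magic_square :: "nat \<Rightarrow> complex \<Rightarrow> complex mat \<Rightarrow> bool" where
  "semi_magic_square n s A \<longleftrightarrow> semi_magic n s A \<and> (\<forall>i<n. \<forall>j<n. A $$ (i, j) \<in> \<nat>)"

definition H_count :: "nat \<Rightarrow> (nat \<Rightarrow> nat) set \<Rightarrow> nat \<Rightarrow> nat" where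
  "H_count n G r = card {A \<in> MM n G. semi_magic_square n (of_nat r) A}"

end

theory Submission
  imports Defs
begin

text \<open>
  With rows and columns indexed from \<open>0\<close>, the matrix of \<open>R\<^sup>k\<close> has its ones where \<open>j - i\<close> is a
  fixed residue modulo \<open>n\<close>, and the matrix of \<open>C R\<^sup>k\<close> where \<open>i + j\<close> is a fixed residue. The span of
  these matrices therefore consists of all matrices with entries \<open>a (j - i) + b (j + i)\<close> for
  \<open>n\<close>-periodic \<open>a\<close> and \<open>b\<close>; such matrices are closed under products because a product of two of
  them is a sum of four cyclic convolutions or correlations (\<open>toeplitz_hankel_mult\<close>). So this span is the algebra
  (\<open>MM_dihedral\<close>), and the line sum of the matrix is the sum of all \<open>a\<close> and \<open>b\<close> over one period.

  For even \<open>n = 2 * m\<close> the residues \<open>u = j - i\<close> and \<open>v = j + i\<close> have the same parity, and every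
  pair \<open>(u, v)\<close> of equal parity does occur (\<open>residues_diff_sum_iff\<close>). Hence the matrix carries
  exactly the information of two independent \<open>m\<close> by \<open>m\<close> tables \<open>a u + b v\<close>, one for even and one
  for odd residues. A table of this shape with entries in the naturals determines \<open>a\<close> and \<open>b\<close> up to
  moving a constant from one to the other, and it has a unique representation with \<open>a\<close> and \<open>b\<close>
  natural and \<open>min b = 0\<close> (\<open>nonneg_additive_normal_form\<close>, \<open>inj_on_square_of_list\<close>).

  Semi-magic squares with line sum \<open>r\<close> thus correspond to compositions of \<open>r\<close> into \<open>2 * n\<close>
  non-negative parts in which two disjoint blocks of \<open>m\<close> parts, the values of \<open>b\<close> at even and at odd
  residues, each contain a zero. Removing the compositions that are positive on one of the
  blocks, by inclusion and exclusion, gives the three binomial coefficients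
  (\<open>card_compositions_with_zeros\<close>). In terms of generating functions, each block contributes the
  factor \<open>1 - x\<^sup>m\<close> to \<open>1 / (1 - x)\<close> to the power \<open>2 * n\<close>.
\<close>

section \<open>Sums of periodic functions over a period\<close>

text \<open>
  The argument is an integer so that \<open>j - i\<close> and its shifts can be formed without truncation.
\<close>

definition periodic :: "nat \<Rightarrow> (int \<Rightarrow> 'a) \<Rightarrow> bool" where
  "periodic n f \<longleftrightarrow> (\<forall>x y. x mod int n = y mod int n \<longrightarrow> f x = f y)"

lemma periodicD: "periodic n f \<Longrightarrow> x mod int n = y mod int n \<Longrightarrow> f x = f y"
  unfolding periodic_def by blast

lemma periodic_add_period: "periodic n f \<Longrightarrow> f (x + int n) = f x"
  by (erule periodicD) simp

lemma periodic_shift: "periodic n f \<Longrightarrow> periodic n (\<lambda>x. f (x + c))"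
  unfolding periodic_def using mod_add_cong[OF _ refl] by blast

lemma periodic_reflect: "periodic n f \<Longrightarrow> periodic n (\<lambda>x. f (c - x))"
  unfolding periodic_def using mod_diff_cong[OF refl] by blast

lemma periodic_combine:
  "periodic n f \<Longrightarrow> periodic n g \<Longrightarrow> periodic n (\<lambda>x. h (f x) (g x))"
  unfolding periodic_def by metis

lemma periodic_comp: "periodic n f \<Longrightarrow> periodic n (\<lambda>x. h (f x))"
  by (rule periodic_combine)

text \<open>
  Shifting by one changes the sum over a period by \<open>f (n + c) - f c\<close>, which vanishes.
\<close>

lemma sum_periodic_shift_nat:
  fixes f :: "int \<Rightarrow> 'a::ab_group_add"
  assumes "periodic n f"
  shows "(\<Sum>k<n. f (int k + int c)) = (\<Sum>k<n. f (int k))"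
proof (induction c)
  case (Suc c)
  have "(\<Sum>k<n. f (int (Suc k) + int c)) - (\<Sum>k<n. f (int k + int c)) =
      f (int n + int c) - f (int 0 + int c)"
    unfolding sum_subtractf[symmetric]
    by (rule sum_lessThan_telescope[of "\<lambda>k. f (int k + int c)"])
  also have "\<dots> = 0"
    using periodic_add_period[OF assms, of "int c"] by (simp add: add.commute)
  finally show ?case
    using Suc by (simp add: algebra_simps)
qed simp

lemma sum_periodic_shift:
  fixes f :: "int \<Rightarrow> 'a::ab_group_add"
  assumes "periodic n f"
  shows "(\<Sum>k<n. f (int k + c)) = (\<Sum>k<n. f (int k))"
proof (cases "n = 0")
  case False
  have "f (int k + c) = f (int k + int (nat (c mod int n)))" for k
    using False by (intro periodicD[OF assms] mod_add_cong) simp_all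
  then show ?thesis
    using sum_periodic_shift_nat[OF assms, of "nat (c mod int n)"] by (simp only:)
qed simp

lemma sum_periodic_reflect:
  fixes f :: "int \<Rightarrow> 'a::ab_group_add"
  assumes "periodic n f"
  shows "(\<Sum>k<n. f (c - int k)) = (\<Sum>k<n. f (int k))"
proof -
  have "(\<Sum>k<n. f (c - int k)) = (\<Sum>k<n. f (c - int (n - Suc k)))"
    by (rule sum.nat_diff_reindex[symmetric])
  also have "\<dots> = (\<Sum>k<n. f (int k + (c + 1)))"
  proof (rule sum.cong[OF refl])
    fix k assume "k \<in> {..<n}"
    then have "c - int (n - Suc k) + int n = int k + (c + 1)"
      by (simp add: of_nat_diff)
    then show "f (c - int (n - Suc k)) = f (int k + (c + 1))"
      using periodic_add_period[OF assms, of "c - int (n - Suc k)"] by metis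
  qed
  finally show ?thesis
    using sum_periodic_shift[OF assms] by simp
qed

section \<open>Matrices depending on difference and sum of the indices\<close>

definition toeplitz_hankel :: "nat \<Rightarrow> (int \<Rightarrow> complex) \<Rightarrow> (int \<Rightarrow> complex) \<Rightarrow> complex mat" where
  "toeplitz_hankel n a b = mat n n (\<lambda>(j, i). a (int j - int i) + b (int j + int i))"

definition toeplitz_hankel_space :: "nat \<Rightarrow> complex mat set" where
  "toeplitz_hankel_space n = {toeplitz_hankel n a b |a b. periodic n a \<and> periodic n b}"

lemma toeplitz_hankel_spaceI:
  "periodic n a \<Longrightarrow> periodic n b \<Longrightarrow> toeplitz_hankel n a b \<in> toeplitz_hankel_space n"
  unfolding toeplitz_hankel_space_def by blast

lemma toeplitz_hankel_spaceE:
  assumes "A \<in> toeplitz_hankel_space n"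
  obtains a b where "periodic n a" "periodic n b" "A = toeplitz_hankel n a b"
  using assms unfolding toeplitz_hankel_space_def by blast

text \<open>
  Expanding an entry of the product gives four sums over \<open>k\<close>; substituting \<open>k + i\<close> or \<open>k - i\<close> for
  \<open>k\<close> turns each of them into a function of \<open>j - i\<close> alone or of \<open>j + i\<close> alone. This mirrors the
  multiplication of the group: the product of two rotations or of two reflections is a rotation,
  a mixed product is a reflection.
\<close>

lemma toeplitz_hankel_mult:
  assumes a: "periodic n a" and b: "periodic n b"
    and a': "periodic n a'" and b': "periodic n b'"
  shows "toeplitz_hankel n a b * toeplitz_hankel n a' b' = toeplitz_hankel n
    (\<lambda>x. (\<Sum>k<n. a (x - int k) * a' (int k)) + (\<Sum>k<n. b (x + int k) * b' (int k)))
    (\<lambda>x. (\<Sum>k<n. a (x - int k) * b' (int k)) + (\<Sum>k<n. b (x + int k) * a' (int k)))"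
    (is "_ = ?R")
proof (rule eq_matI)
  fix j i assume "j < dim_row ?R" and "i < dim_col ?R"
  then have j: "j < n" and i: "i < n"
    by (auto simp: toeplitz_hankel_def)
  let ?j = "int j" and ?i = "int i"
  have "(toeplitz_hankel n a b * toeplitz_hankel n a' b') $$ (j, i) =
     (\<Sum>k<n. (a (?j - int k) + b (?j + int k)) * (a' (int k - ?i) + b' (int k + ?i)))"
    using j i by (simp add: toeplitz_hankel_def scalar_prod_def atLeast0LessThan)
  also have "\<dots> = (\<Sum>k<n. a (?j - int k) * a' (int k - ?i)) + (\<Sum>k<n. b (?j + int k) * b' (int k + ?i))
     + ((\<Sum>k<n. a (?j - int k) * b' (int k + ?i)) + (\<Sum>k<n. b (?j + int k) * a' (int k - ?i)))"
    by (simp add: algebra_simps sum.distrib)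
  also have "(\<Sum>k<n. a (?j - int k) * a' (int k - ?i)) = (\<Sum>k<n. a (?j - ?i - int k) * a' (int k))"
    using sum_periodic_shift[OF periodic_combine[OF periodic_reflect[OF a, of "?j - ?i"] a', of "(*)"], of "- ?i"]
    by (simp add: algebra_simps)
  also have "(\<Sum>k<n. b (?j + int k) * b' (int k + ?i)) = (\<Sum>k<n. b (?j - ?i + int k) * b' (int k))"
    using sum_periodic_shift[OF periodic_combine[OF periodic_shift[OF b, of "?j - ?i"] b', of "(*)"], of "?i"]
    by (simp add: algebra_simps)
  also have "(\<Sum>k<n. a (?j - int k) * b' (int k + ?i)) = (\<Sum>k<n. a (?j + ?i - int k) * b' (int k))"
    using sum_periodic_shift[OF periodic_combine[OF periodic_reflect[OF a, of "?j + ?i"] b', of "(*)"], of "?i"]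
    by (simp add: algebra_simps)
  also have "(\<Sum>k<n. b (?j + int k) * a' (int k - ?i)) = (\<Sum>k<n. b (?j + ?i + int k) * a' (int k))"
    using sum_periodic_shift[OF periodic_combine[OF periodic_shift[OF b, of "?j + ?i"] a', of "(*)"], of "- ?i"]
    by (simp add: algebra_simps)
  finally show "(toeplitz_hankel n a b * toeplitz_hankel n a' b') $$ (j, i) = ?R $$ (j, i)"
    using j i by (simp add: toeplitz_hankel_def)
qed (simp_all add: toeplitz_hankel_def)

lemma periodic_sum: "(\<And>k. periodic n (f k)) \<Longrightarrow> periodic n (\<lambda>x. \<Sum>k\<in>K. f k x)"
  unfolding periodic_def by (metis (no_types, lifting) sum.cong)

lemma toeplitz_hankel_space_mult:
  assumes "A \<in> toeplitz_hankel_space n" and "B \<in> toeplitz_hankel_space n"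
  shows "A * B \<in> toeplitz_hankel_space n"
proof -
  obtain a b where p1: "periodic n a" "periodic n b" and A: "A = toeplitz_hankel n a b"
    by (rule toeplitz_hankel_spaceE[OF assms(1)])
  obtain a' b' where p2: "periodic n a'" "periodic n b'" and B: "B = toeplitz_hankel n a' b'"
    by (rule toeplitz_hankel_spaceE[OF assms(2)])
  note p = p1 p2 and AB = A B
  have conv: "periodic n (\<lambda>x. (\<Sum>k<n. a (x - int k) * f (int k)) + (\<Sum>k<n. b (x + int k) * g (int k)))"
    for f g :: "int \<Rightarrow> complex"
  proof -
    have "periodic n (\<lambda>x. a (x - int k) * f (int k))" for k
      using periodic_comp[OF periodic_shift[OF p(1), of "- int k"], of "\<lambda>y. y * f (int k)"] by simp
    moreover have "periodic n (\<lambda>x. b (x + int k) * g (int k))" for k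
      by (rule periodic_comp[OF periodic_shift[OF p(2)]])
    ultimately show ?thesis
      by (intro periodic_combine[where h = "(+)"] periodic_sum)
  qed
  show ?thesis
    unfolding AB toeplitz_hankel_mult[OF p] by (intro toeplitz_hankel_spaceI conv)
qed

lemma toeplitz_hankel_space_add:
  assumes "A \<in> toeplitz_hankel_space n" and "B \<in> toeplitz_hankel_space n"
  shows "A + B \<in> toeplitz_hankel_space n"
proof -
  obtain a b where p1: "periodic n a" "periodic n b" and A: "A = toeplitz_hankel n a b"
    by (rule toeplitz_hankel_spaceE[OF assms(1)])
  obtain a' b' where p2: "periodic n a'" "periodic n b'" and B: "B = toeplitz_hankel n a' b'"
    by (rule toeplitz_hankel_spaceE[OF assms(2)])
  note p = p1 p2 and AB = A B
  have "A + B = toeplitz_hankel n (\<lambda>x. a x + a' x) (\<lambda>x. b x + b' x)"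
    unfolding AB by (rule eq_matI) (auto simp: toeplitz_hankel_def)
  then show ?thesis
    using toeplitz_hankel_spaceI periodic_combine[OF p(1,3), of "(+)"] periodic_combine[OF p(2,4), of "(+)"]
    by simp
qed

lemma toeplitz_hankel_space_smult:
  assumes "A \<in> toeplitz_hankel_space n"
  shows "c \<cdot>\<^sub>m A \<in> toeplitz_hankel_space n"
proof -
  obtain a b where p: "periodic n a" "periodic n b" and A: "A = toeplitz_hankel n a b"
    by (rule toeplitz_hankel_spaceE[OF assms])
  have "c \<cdot>\<^sub>m A = toeplitz_hankel n (\<lambda>x. c * a x) (\<lambda>x. c * b x)"
    unfolding A by (rule eq_matI) (auto simp: toeplitz_hankel_def algebra_simps)
  moreover have "periodic n (\<lambda>x. c * a x)" "periodic n (\<lambda>x. c * b x)"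
    by (rule p[THEN periodic_comp])+
  ultimately show ?thesis
    by (simp add: toeplitz_hankel_spaceI)
qed

lemma toeplitz_hankel_space_zero: "0\<^sub>m n n \<in> toeplitz_hankel_space n"
proof -
  have "0\<^sub>m n n = toeplitz_hankel n (\<lambda>_. 0) (\<lambda>_. 0)"
    by (rule eq_matI) (auto simp: toeplitz_hankel_def)
  then show ?thesis
    by (simp add: toeplitz_hankel_spaceI periodic_def)
qed

section \<open>Dihedral permutations as affine maps modulo n\<close>

lemma rotation_eq:
  assumes "n \<ge> 1" and "i \<in> {1..n}"
  shows "rotation n i = (if i = n then 1 else i + 1)"
proof -
  have "map (rotation n) [1..<n + 1] = rotate1 [1..<n + 1]"
    using cyclic_rotation[of "[1..<n + 1]" 1] by (simp add: rotation_def)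
  then have "map (rotation n) [1..<n + 1] ! (i - 1) = rotate1 [1..<n + 1] ! (i - 1)"
    by simp
  moreover have "map (rotation n) [1..<n + 1] ! (i - 1) = rotation n i"
    using assms by (subst nth_map) (auto simp del: upt_Suc)
  moreover have "rotate1 [1..<n + 1] ! (i - 1) = (if i = n then 1 else i + 1)"
    using assms by (subst nth_rotate1) (auto simp del: upt_Suc)
  ultimately show ?thesis
    by simp
qed

lemma rotation_permutes: "rotation n permutes {1..n}"
proof -
  have "set [1..<n + 1] = {1..n}" by auto
  then show ?thesis
    unfolding rotation_def using cycle_permutes by metis
qed

lemma reflection_permutes: "reflection n permutes {1..n}"
proof (rule bij_imp_permutes)
  show "bij_betw (reflection n) {1..n} {1..n}"
    by (rule bij_betw_byWitness[where f' = "reflection n"]) (auto simp: reflection_def)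
qed (auto simp: reflection_def)

text \<open>
  On \<open>{1..n}\<close>, powers of \<open>R\<close> act modulo \<open>n\<close> as \<open>c + i\<close> and the elements \<open>C R\<^sup>k\<close> as \<open>c - i\<close>. Working with
  congruences avoids any case distinction at the point where the rotation wraps around.
\<close>

definition is_rotation :: "nat \<Rightarrow> (nat \<Rightarrow> nat) \<Rightarrow> int \<Rightarrow> bool" where
  "is_rotation n \<sigma> c \<longleftrightarrow> (\<forall>i\<in>{1..n}. int (\<sigma> i) mod int n = (c + int i) mod int n)"

definition is_reflection :: "nat \<Rightarrow> (nat \<Rightarrow> nat) \<Rightarrow> int \<Rightarrow> bool" where
  "is_reflection n \<sigma> c \<longleftrightarrow> (\<forall>i\<in>{1..n}. int (\<sigma> i) mod int n = (c - int i) mod int n)"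

lemma is_rotation_rotation: "is_rotation n (rotation n) 1"
  unfolding is_rotation_def by (auto simp: rotation_eq)

lemma is_reflection_reflection: "is_reflection n (reflection n) 1"
proof -
  have "(1 + int n - int i) mod int n = (1 - int i) mod int n" for i
    using mod_add_self2[of "1 - int i" "int n"] by (simp add: algebra_simps)
  then show ?thesis
    unfolding is_reflection_def by (auto simp: reflection_def of_nat_diff)
qed

lemma is_rotation_reflection_comp:
  assumes \<tau>: "\<tau> permutes {1..n}"
  shows "is_rotation n \<sigma> c \<Longrightarrow> is_rotation n \<tau> d \<Longrightarrow> is_rotation n (\<sigma> \<circ> \<tau>) (c + d)"
    and "is_rotation n \<sigma> c \<Longrightarrow> is_reflection n \<tau> d \<Longrightarrow> is_reflection n (\<sigma> \<circ> \<tau>) (c + d)"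
    and "is_reflection n \<sigma> c \<Longrightarrow> is_rotation n \<tau> d \<Longrightarrow> is_reflection n (\<sigma> \<circ> \<tau>) (c - d)"
    and "is_reflection n \<sigma> c \<Longrightarrow> is_reflection n \<tau> d \<Longrightarrow> is_rotation n (\<sigma> \<circ> \<tau>) (c - d)"
proof -
  have in_range: "i \<in> {1..n} \<Longrightarrow> \<tau> i \<in> {1..n}" for i
    using permutes_in_image[OF \<tau>] by simp
  have rot: "int (\<sigma> (\<tau> i)) mod int n = (c + x) mod int n"
    if "is_rotation n \<sigma> c" "i \<in> {1..n}" "int (\<tau> i) mod int n = x mod int n" for i x
    using that(1) in_range[OF that(2)] mod_add_cong[OF refl that(3), of c]
    unfolding is_rotation_def by simp
  have refl: "int (\<sigma> (\<tau> i)) mod int n = (c - x) mod int n"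
    if "is_reflection n \<sigma> c" "i \<in> {1..n}" "int (\<tau> i) mod int n = x mod int n" for i x
    using that(1) in_range[OF that(2)] mod_diff_cong[OF refl that(3), of c]
    unfolding is_reflection_def by simp
  show "is_rotation n \<sigma> c \<Longrightarrow> is_rotation n \<tau> d \<Longrightarrow> is_rotation n (\<sigma> \<circ> \<tau>) (c + d)"
    using rot unfolding is_rotation_def[of n \<tau>] is_rotation_def[of n "\<sigma> \<circ> \<tau>"]
    by (simp add: add.assoc)
  show "is_rotation n \<sigma> c \<Longrightarrow> is_reflection n \<tau> d \<Longrightarrow> is_reflection n (\<sigma> \<circ> \<tau>) (c + d)"
    using rot unfolding is_reflection_def[of n \<tau>] is_reflection_def[of n "\<sigma> \<circ> \<tau>"]
    by (simp add: add_diff_eq[symmetric])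
  show "is_reflection n \<sigma> c \<Longrightarrow> is_rotation n \<tau> d \<Longrightarrow> is_reflection n (\<sigma> \<circ> \<tau>) (c - d)"
    using refl unfolding is_rotation_def[of n \<tau>] is_reflection_def[of n "\<sigma> \<circ> \<tau>"]
    by (simp add: diff_diff_eq)
  show "is_reflection n \<sigma> c \<Longrightarrow> is_reflection n \<tau> d \<Longrightarrow> is_rotation n (\<sigma> \<circ> \<tau>) (c - d)"
    using refl unfolding is_reflection_def[of n \<tau>] is_rotation_def[of n "\<sigma> \<circ> \<tau>"]
    by (simp add: diff_diff_eq2 diff_add_eq)
qed

lemma dihedral_permutes:
  assumes "\<sigma> \<in> dihedral n"
  shows "\<sigma> permutes {1..n}"
proof -
  have "{rotation n, reflection n} \<subseteq> carrier (sym_group n)"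
    using rotation_permutes reflection_permutes sym_group_carrier by blast
  then have "\<sigma> \<in> carrier (sym_group n)"
    using group.generate_in_carrier[OF sym_group_is_group] assms unfolding dihedral_def by blast
  then show ?thesis
    using sym_group_carrier by blast
qed

lemma is_rotation_inv:
  assumes \<sigma>: "\<sigma> permutes {1..n}"
  shows "is_rotation n \<sigma> c \<Longrightarrow> is_rotation n (inv' \<sigma>) (- c)"
    and "is_reflection n \<sigma> c \<Longrightarrow> is_reflection n (inv' \<sigma>) c"
proof -
  have *: "i \<in> {1..n} \<Longrightarrow> inv' \<sigma> i \<in> {1..n}" "\<sigma> (inv' \<sigma> i) = i" for i
    using permutes_in_image[OF permutes_inv[OF \<sigma>]] permutes_inverses(1)[OF \<sigma>] by auto
  show "is_rotation n (inv' \<sigma>) (- c)" if "is_rotation n \<sigma> c"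
    unfolding is_rotation_def
  proof
    fix i assume "i \<in> {1..n}"
    then have "int i mod int n = (c + int (inv' \<sigma> i)) mod int n"
      using * that unfolding is_rotation_def by metis
    then have "(- c + int i) mod int n = (- c + (c + int (inv' \<sigma> i))) mod int n"
      by (rule mod_add_cong[OF refl])
    then show "int (inv' \<sigma> i) mod int n = (- c + int i) mod int n" by simp
  qed
  show "is_reflection n (inv' \<sigma>) c" if "is_reflection n \<sigma> c"
    unfolding is_reflection_def
  proof
    fix i assume "i \<in> {1..n}"
    then have "int i mod int n = (c - int (inv' \<sigma> i)) mod int n"
      using * that unfolding is_reflection_def by metis
    then have "(c - int i) mod int n = (c - (c - int (inv' \<sigma> i))) mod int n"
      by (rule mod_diff_cong[OF refl])
    then show "int (inv' \<sigma> i) mod int n = (c - int i) mod int n" by simp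
  qed
qed

lemma dihedral_cases:
  assumes "\<sigma> \<in> dihedral n"
  shows "(\<exists>c. is_rotation n \<sigma> c) \<or> (\<exists>c. is_reflection n \<sigma> c)"
  using assms unfolding dihedral_def
proof (induction rule: generate.induct)
  case one
  have "is_rotation n id 0"
    by (simp add: is_rotation_def)
  then show ?case
    unfolding sym_group_one by blast
next
  case (incl \<sigma>)
  then show ?case
    using is_rotation_rotation is_reflection_reflection by blast
next
  case (inv \<sigma>)
  then have "\<sigma> permutes {1..n}"
    using rotation_permutes reflection_permutes by blast
  then show ?case
    using inv is_rotation_rotation is_reflection_reflection is_rotation_inv
    by (metis insert_iff singletonD sym_group_carrier sym_group_inv_equality)
next
  case (eng \<sigma> \<tau>)
  have "\<tau> permutes {1..n}"
    using eng.hyps(2) dihedral_permutes unfolding dihedral_def by blast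
  then show ?case
    unfolding sym_group_mult using eng.IH is_rotation_reflection_comp[of \<tau> n \<sigma>] by blast
qed

lemma dihedral_comp: "\<sigma> \<in> dihedral n \<Longrightarrow> \<tau> \<in> dihedral n \<Longrightarrow> \<sigma> \<circ> \<tau> \<in> dihedral n"
  using generate.eng[of \<sigma> "sym_group n" _ \<tau>] by (simp only: dihedral_def sym_group_mult)

lemma rotation_in_dihedral: "rotation n \<in> dihedral n"
  and reflection_in_dihedral: "reflection n \<in> dihedral n"
  unfolding dihedral_def by (simp_all add: generate.incl)

lemma dihedral_rotation_exists: "\<exists>\<sigma>\<in>dihedral n. is_rotation n \<sigma> (int k)"
proof (induction k)
  case 0
  have "id \<in> dihedral n"
    unfolding dihedral_def using generate.one[of "sym_group n"] by (simp add: sym_group_one)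
  then show ?case
    by (intro bexI[of _ id]) (auto simp: is_rotation_def)
next
  case (Suc k)
  then obtain \<sigma> where \<sigma>: "\<sigma> \<in> dihedral n" "is_rotation n \<sigma> (int k)"
    by blast
  have "rotation n \<circ> \<sigma> \<in> dihedral n"
    by (rule dihedral_comp[OF rotation_in_dihedral \<sigma>(1)])
  moreover have "is_rotation n (rotation n \<circ> \<sigma>) (1 + int k)"
    by (rule is_rotation_reflection_comp(1)[OF dihedral_permutes[OF \<sigma>(1)] is_rotation_rotation \<sigma>(2)])
  ultimately show ?case
    by auto
qed

text \<open>
  The reflection after the rotation by \<open>k\<close> acts as \<open>1 - k - i\<close>, so \<open>k\<close> is chosen as the
  residue of \<open>1 - c\<close>.
\<close>

lemma dihedral_reflection_exists:
  assumes "n \<ge> 1"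
  shows "\<exists>\<sigma>\<in>dihedral n. is_reflection n \<sigma> c"
proof -
  define k where "k = nat ((1 - c) mod int n)"
  have k: "int k = (1 - c) mod int n"
    using assms by (simp add: k_def)
  obtain \<sigma> where \<sigma>: "\<sigma> \<in> dihedral n" "is_rotation n \<sigma> (int k)"
    using dihedral_rotation_exists by blast
  have "reflection n \<circ> \<sigma> \<in> dihedral n"
    by (rule dihedral_comp[OF reflection_in_dihedral \<sigma>(1)])
  moreover have "is_reflection n (reflection n \<circ> \<sigma>) (1 - int k)"
    by (rule is_rotation_reflection_comp(3)[OF dihedral_permutes[OF \<sigma>(1)] is_reflection_reflection \<sigma>(2)])
  moreover have "(1 - int k - int i) mod int n = (c - int i) mod int n" for i
  proof -
    have "(1 - int k) mod int n = (1 - (1 - c)) mod int n"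
      by (rule mod_diff_cong) (simp_all add: k)
    then show ?thesis
      by (intro mod_diff_cong) simp_all
  qed
  ultimately have "is_reflection n (reflection n \<circ> \<sigma>) c"
    unfolding is_reflection_def by simp
  then show ?thesis
    using \<open>reflection n \<circ> \<sigma> \<in> dihedral n\<close> by (rule bexI)
qed

section \<open>The algebra generated by the dihedral permutation matrices\<close>

definition residue_indicator :: "nat \<Rightarrow> int \<Rightarrow> int \<Rightarrow> complex" where
  "residue_indicator n c x = (if x mod int n = c mod int n then 1 else 0)"

lemma periodic_residue_indicator [simp]: "periodic n (residue_indicator n c)"
  by (simp add: periodic_def residue_indicator_def)

text \<open>
  A periodic function is a linear combination of the indicators of the residues. As an induction
  rule, this shows membership in a subspace without forming finite sums of matrices.
\<close>

lemma periodic_induct [consumes 2, case_names zero add]: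
  fixes f :: "int \<Rightarrow> complex"
  assumes n: "1 \<le> n" and f: "periodic n f"
    and zero: "P (\<lambda>_. 0)"
    and add: "\<And>g c k. P g \<Longrightarrow> P (\<lambda>x. g x + c * residue_indicator n (int k) x)"
  shows "P f"
proof -
  \<comment> \<open>The function is built up one residue at a time.\<close>
  have "P (\<lambda>x. if x mod int n < int K then f x else 0)" if "K \<le> n" for K
    using that
  proof (induction K)
    case 0
    have "\<not> x mod int n < int 0" for x
      using pos_mod_sign[of "int n" x] n by linarith
    then show ?case
      using zero by simp
  next
    case (Suc K)
    have "(\<lambda>x. if x mod int n < int (Suc K) then f x else 0) =
        (\<lambda>x. (if x mod int n < int K then f x else 0) + f (int K) * residue_indicator n (int K) x)"
    proof
      fix x
      have K: "int K mod int n = int K"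
        using Suc.prems by simp
      show "(if x mod int n < int (Suc K) then f x else 0) =
          (if x mod int n < int K then f x else 0) + f (int K) * residue_indicator n (int K) x"
      proof (cases "x mod int n = int K")
        case True
        then have "f x = f (int K)"
          using K by (intro periodicD[OF f]) simp
        then show ?thesis
          using True K by (simp add: residue_indicator_def)
      next
        case False
        then show ?thesis
          using K by (auto simp: residue_indicator_def)
      qed
    qed
    then show ?case
      using add[OF Suc.IH, of "f (int K)" K] Suc.prems by simp
  qed
  from this[of n] show ?thesis
    using n by simp
qed

lemma eq_iff_mod_eq:
  assumes "s \<in> {1..n}" and "t \<in> {1..n}"
  shows "s = t \<longleftrightarrow> int s mod int n = int t mod int n"
proof
  assume "int s mod int n = int t mod int n"
  then have "(int s - 1) mod int n = (int t - 1) mod int n"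
    by (rule mod_diff_cong) simp
  then show "s = t"
    using assms by simp
qed simp

lemma mod_eq_add_cancel: "(x + z) mod n = (y + z) mod n \<longleftrightarrow> x mod n = y mod n" for x y z n :: int
  by (simp add: mod_eq_dvd_iff)

lemma perm_mat_entry:
  assumes "\<sigma> permutes {1..n}" and "j < n" and "i < n"
  shows "perm_mat n \<sigma> $$ (j, i) =
    (if int (\<sigma> (i + 1)) mod int n = (int j + 1) mod int n then 1 else 0)"
proof -
  have "\<sigma> (i + 1) \<in> {1..n}"
    using permutes_in_image[OF assms(1), of "i + 1"] assms(3) by simp
  then have "\<sigma> (i + 1) = j + 1 \<longleftrightarrow> int (\<sigma> (i + 1)) mod int n = int (j + 1) mod int n"
    using assms(2) by (intro eq_iff_mod_eq) auto
  then show ?thesis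
    using assms(2,3) by (simp add: perm_mat_def add.commute)
qed

lemma perm_mat_is_rotation:
  assumes \<sigma>: "\<sigma> permutes {1..n}" and c: "is_rotation n \<sigma> c"
  shows "perm_mat n \<sigma> = toeplitz_hankel n (residue_indicator n c) (\<lambda>_. 0)"
proof (rule eq_matI)
  fix j i
  assume "j < dim_row (toeplitz_hankel n (residue_indicator n c) (\<lambda>_. 0))"
    and "i < dim_col (toeplitz_hankel n (residue_indicator n c) (\<lambda>_. 0))"
  then have ji: "j < n" "i < n"
    by (simp_all add: toeplitz_hankel_def)
  have "int (\<sigma> (i + 1)) mod int n = (c + int (i + 1)) mod int n"
    using c ji by (simp add: is_rotation_def)
  then have "int (\<sigma> (i + 1)) mod int n = (int j + 1) mod int n
      \<longleftrightarrow> (c + int (i + 1)) mod int n = (int j - int i + int (i + 1)) mod int n"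
    by simp
  also have "\<dots> \<longleftrightarrow> (int j - int i) mod int n = c mod int n"
    unfolding mod_eq_add_cancel by auto
  finally show "perm_mat n \<sigma> $$ (j, i) = toeplitz_hankel n (residue_indicator n c) (\<lambda>_. 0) $$ (j, i)"
    unfolding perm_mat_entry[OF \<sigma> ji] using ji
    by (simp add: toeplitz_hankel_def residue_indicator_def)
qed (simp_all add: perm_mat_def toeplitz_hankel_def)

text \<open>
  The offset \<open>2\<close> appears because the permuted points are \<open>i + 1\<close> and \<open>j + 1\<close>, and their sum is to be
  expressed by \<open>j + i\<close>; for rotations the two shifts cancel in \<open>j - i\<close>.
\<close>

lemma perm_mat_is_reflection:
  assumes \<sigma>: "\<sigma> permutes {1..n}" and c: "is_reflection n \<sigma> (c + 2)"
  shows "perm_mat n \<sigma> = toeplitz_hankel n (\<lambda>_. 0) (residue_indicator n c)"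
proof (rule eq_matI)
  fix j i
  assume "j < dim_row (toeplitz_hankel n (\<lambda>_. 0) (residue_indicator n c))"
    and "i < dim_col (toeplitz_hankel n (\<lambda>_. 0) (residue_indicator n c))"
  then have ji: "j < n" "i < n"
    by (simp_all add: toeplitz_hankel_def)
  have "int (\<sigma> (i + 1)) mod int n = (c + 2 - int (i + 1)) mod int n"
    using c ji by (simp add: is_reflection_def)
  moreover have "c + 2 - int (i + 1) = c + (1 - int i)"
    "int j + 1 = int j + int i + (1 - int i)"
    by simp_all
  ultimately have "int (\<sigma> (i + 1)) mod int n = (int j + 1) mod int n
      \<longleftrightarrow> (c + (1 - int i)) mod int n = (int j + int i + (1 - int i)) mod int n"
    by (simp only:)
  also have "\<dots> \<longleftrightarrow> (int j + int i) mod int n = c mod int n"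
    unfolding mod_eq_add_cancel by auto
  finally show "perm_mat n \<sigma> $$ (j, i) = toeplitz_hankel n (\<lambda>_. 0) (residue_indicator n c) $$ (j, i)"
    unfolding perm_mat_entry[OF \<sigma> ji] using ji
    by (simp add: toeplitz_hankel_def residue_indicator_def)
qed (simp_all add: perm_mat_def toeplitz_hankel_def)

lemma periodic_zero [simp]: "periodic n (\<lambda>_. 0)"
  by (simp add: periodic_def)

lemma perm_mat_dihedral_in_space:
  assumes "\<sigma> \<in> dihedral n"
  shows "perm_mat n \<sigma> \<in> toeplitz_hankel_space n"
  using dihedral_cases[OF assms]
proof (elim disjE exE)
  fix c assume "is_rotation n \<sigma> c"
  then show ?thesis
    by (simp add: perm_mat_is_rotation[OF dihedral_permutes[OF assms]] toeplitz_hankel_spaceI)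
next
  fix c assume "is_reflection n \<sigma> c"
  then have "is_reflection n \<sigma> ((c - 2) + 2)"
    by simp
  then show ?thesis
    using perm_mat_is_reflection[OF dihedral_permutes[OF assms]] by (simp only: toeplitz_hankel_spaceI periodic_zero periodic_residue_indicator)
qed

text \<open>
  The matrices of this shape contain the generators and are closed under all operations of the
  algebra. Conversely, the indicator of each residue, as \<open>a\<close> or as \<open>b\<close>, gives the matrix of a
  group element, and the indicators span all periodic functions.
\<close>

lemma MM_dihedral:
  assumes n: "1 \<le> n"
  shows "MM n (dihedral n) = toeplitz_hankel_space n"
proof (intro subset_antisym subsetI)
  fix A assume "A \<in> MM n (dihedral n)"
  then show "A \<in> toeplitz_hankel_space n"
    unfolding MM_def
  proof (induction rule: generated_algebra.induct)
    case (incl A)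
    then show ?case using perm_mat_dihedral_in_space by blast
  qed (simp_all add: toeplitz_hankel_space_zero toeplitz_hankel_space_add
      toeplitz_hankel_space_smult toeplitz_hankel_space_mult)
next
  fix A assume "A \<in> toeplitz_hankel_space n"
  then obtain a b where a: "periodic n a" and b: "periodic n b" and A: "A = toeplitz_hankel n a b"
    by (rule toeplitz_hankel_spaceE)
  let ?M = "MM n (dihedral n)"
  have zero: "toeplitz_hankel n (\<lambda>_. 0) (\<lambda>_. 0) \<in> ?M"
  proof -
    have "toeplitz_hankel n (\<lambda>_. 0) (\<lambda>_. 0) = 0\<^sub>m n n"
      by (rule eq_matI) (auto simp: toeplitz_hankel_def)
    then show ?thesis
      by (simp add: MM_def generated_algebra.zero)
  qed
  have add_smult: "B + c \<cdot>\<^sub>m perm_mat n \<sigma> \<in> ?M" if "B \<in> ?M" "\<sigma> \<in> dihedral n" for B c \<sigma>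
    using that unfolding MM_def
    by (intro generated_algebra.add generated_algebra.smult generated_algebra.incl[of "perm_mat n \<sigma>"]) simp_all
  have "toeplitz_hankel n a (\<lambda>_. 0) \<in> ?M"
    using n a
  proof (induction rule: periodic_induct)
    case (add g c k)
    obtain \<sigma> where \<sigma>: "\<sigma> \<in> dihedral n" "is_rotation n \<sigma> (int k)"
      using dihedral_rotation_exists by blast
    have "toeplitz_hankel n (\<lambda>x. g x + c * residue_indicator n (int k) x) (\<lambda>_. 0)
        = toeplitz_hankel n g (\<lambda>_. 0) + c \<cdot>\<^sub>m perm_mat n \<sigma>"
      unfolding perm_mat_is_rotation[OF dihedral_permutes[OF \<sigma>(1)] \<sigma>(2)]
      by (rule eq_matI) (auto simp: toeplitz_hankel_def)
    then show ?case
      using add_smult[OF add \<sigma>(1)] by simp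
  qed (rule zero)
  moreover have "toeplitz_hankel n (\<lambda>_. 0) b \<in> ?M"
    using n b
  proof (induction rule: periodic_induct)
    case (add g c k)
    obtain \<sigma> where \<sigma>: "\<sigma> \<in> dihedral n" "is_reflection n \<sigma> (int k + 2)"
      using dihedral_reflection_exists[OF n] by blast
    have "toeplitz_hankel n (\<lambda>_. 0) (\<lambda>x. g x + c * residue_indicator n (int k) x)
        = toeplitz_hankel n (\<lambda>_. 0) g + c \<cdot>\<^sub>m perm_mat n \<sigma>"
      unfolding perm_mat_is_reflection[OF dihedral_permutes[OF \<sigma>(1)] \<sigma>(2)]
      by (rule eq_matI) (auto simp: toeplitz_hankel_def)
    then show ?case
      using add_smult[OF add \<sigma>(1)] by simp
  qed (rule zero)
  ultimately have "toeplitz_hankel n a (\<lambda>_. 0) + toeplitz_hankel n (\<lambda>_. 0) b \<in> ?M"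
    unfolding MM_def by (rule generated_algebra.add)
  also have "toeplitz_hankel n a (\<lambda>_. 0) + toeplitz_hankel n (\<lambda>_. 0) b = A"
    unfolding A by (rule eq_matI) (auto simp: toeplitz_hankel_def)
  finally show "A \<in> ?M" .
qed

text \<open>
  Along a row or a column both \<open>j - i\<close> and \<open>j + i\<close> run through a full period.
\<close>

lemma semi_magic_toeplitz_hankel_iff:
  assumes a: "periodic n a" and b: "periodic n b" and n: "1 \<le> n"
  shows "semi_magic n s (toeplitz_hankel n a b) \<longleftrightarrow> (\<Sum>k<n. a (int k)) + (\<Sum>k<n. b (int k)) = s"
proof -
  have "(\<Sum>i<n. toeplitz_hankel n a b $$ (j, i)) = (\<Sum>k<n. a (int k)) + (\<Sum>k<n. b (int k))"
    if "j < n" for j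
    using that sum_periodic_reflect[OF a, of "int j"] sum_periodic_shift[OF b, of "int j"]
    by (simp add: toeplitz_hankel_def sum.distrib add.commute)
  moreover have "(\<Sum>j<n. toeplitz_hankel n a b $$ (j, i)) = (\<Sum>k<n. a (int k)) + (\<Sum>k<n. b (int k))"
    if "i < n" for i
    using that sum_periodic_shift[OF a, of "- int i"] sum_periodic_shift[OF b, of "int i"]
    by (simp add: toeplitz_hankel_def sum.distrib)
  moreover have "toeplitz_hankel n a b \<in> carrier_mat n n"
    by (simp add: toeplitz_hankel_def)
  moreover have "0 < n"
    using n by simp
  ultimately show ?thesis
    unfolding semi_magic_def by auto
qed

section \<open>Compositions with a zero in each of two blocks\<close>

definition positive_compositions :: "nat \<Rightarrow> nat \<Rightarrow> nat set \<Rightarrow> nat list set" where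
  "positive_compositions k r P = {l. length l = k \<and> sum_list l = r \<and> (\<forall>i\<in>P. 0 < l ! i)}"

lemma positive_compositions_Un:
  "positive_compositions k r (P \<union> Q) = positive_compositions k r P \<inter> positive_compositions k r Q"
  unfolding positive_compositions_def by auto

lemma finite_positive_compositions [simp]: "finite (positive_compositions k r P)"
proof (rule finite_subset)
  show "positive_compositions k r P \<subseteq> {l. set l \<subseteq> {..r} \<and> length l = k}"
    unfolding positive_compositions_def using member_le_sum_list by fastforce
qed (rule finite_lists_length_eq, simp)

lemma sum_list_eq_sum_nth: "length l = k \<Longrightarrow> sum_list l = (\<Sum>i<k. l ! i)"
  by (auto simp: sum_list_sum_nth atLeast0LessThan)

text \<open>
  Subtracting one at each position in \<open>P\<close> leads to arbitrary compositions of \<open>r - card P\<close>. If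
  \<open>card P\<close> exceeds \<open>r\<close> there is no such composition, and the binomial coefficient vanishes as well;
  for this case with truncated subtraction \<open>k - 1\<close> must be positive.
\<close>

lemma card_positive_compositions:
  assumes P: "P \<subseteq> {..<k}" and k: "2 \<le> k"
  shows "card (positive_compositions k r P) = (r + k - 1 - card P) choose (k - 1)"
proof -
  have "finite P"
    using P finite_subset by blast
  have ind: "(\<Sum>i<k. if i \<in> P then 1 else 0) = card P"
    using P by (simp add: sum.If_cases Int_absorb1)
  have cP: "card P \<le> k"
    using card_mono[OF _ P] by simp
  show ?thesis
  proof (cases "card P \<le> r")
    case True
    let ?add = "\<lambda>l. map (\<lambda>i. l ! i + (if i \<in> P then 1 else 0)) [0..<k]"
    let ?sub = "\<lambda>l. map (\<lambda>i. l ! i - (if i \<in> P then 1 else 0)) [0..<k]"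
    let ?W = "{l :: nat list. length l = k \<and> sum_list l = r - card P}"
    have "bij_betw ?add ?W (positive_compositions k r P)"
    proof (rule bij_betw_byWitness[where f' = ?sub])
      show "\<forall>l\<in>?W. ?sub (?add l) = l"
        by (auto intro!: nth_equalityI)
      show "\<forall>l\<in>positive_compositions k r P. ?add (?sub l) = l"
        by (auto simp: positive_compositions_def intro!: nth_equalityI)
      show "?add ` ?W \<subseteq> positive_compositions k r P"
      proof (rule image_subsetI)
        fix l assume "l \<in> ?W"
        then have l: "length l = k" "(\<Sum>i<k. l ! i) = r - card P"
          by (auto simp: sum_list_eq_sum_nth)
        have "sum_list (?add l) = (\<Sum>i<k. l ! i + (if i \<in> P then 1 else 0))"
          by (subst sum_list_eq_sum_nth[of _ k]) auto
        also have "\<dots> = r"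
          using l(2) True by (simp add: sum.distrib ind)
        finally show "?add l \<in> positive_compositions k r P"
          using P by (auto simp: positive_compositions_def)
      qed
      show "?sub ` positive_compositions k r P \<subseteq> ?W"
      proof (rule image_subsetI)
        fix l assume "l \<in> positive_compositions k r P"
        then have l: "length l = k" "(\<Sum>i<k. l ! i) = r" "\<And>i. i \<in> P \<Longrightarrow> 0 < l ! i"
          by (auto simp: positive_compositions_def sum_list_eq_sum_nth)
        have "sum_list (?sub l) = (\<Sum>i<k. l ! i - (if i \<in> P then 1 else 0))"
          by (subst sum_list_eq_sum_nth[of _ k]) auto
        also have "\<dots> = (\<Sum>i<k. l ! i) - (\<Sum>i<k. if i \<in> P then 1 else 0)"
          by (rule sum_subtractf_nat) (use l(3) in \<open>auto simp: Suc_le_eq\<close>)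
        finally show "?sub l \<in> ?W"
          using l(2) by (simp add: ind)
      qed
    qed
    then have "card (positive_compositions k r P) = card ?W"
      by (rule bij_betw_same_card[symmetric])
    also have "\<dots> = (r - card P + k - 1) choose (r - card P)"
      by (rule card_length_sum_list)
    also have "\<dots> = (r - card P + k - 1) choose (k - 1)"
      using k by (subst binomial_symmetric) auto
    also have "r - card P + k - 1 = r + k - 1 - card P"
      using True by simp
    finally show ?thesis .
  next
    case False
    have "l \<notin> positive_compositions k r P" for l
    proof
      assume "l \<in> positive_compositions k r P"
      then have l: "(\<Sum>i<k. l ! i) = r" "\<And>i. i \<in> P \<Longrightarrow> 0 < l ! i"
        by (auto simp: positive_compositions_def sum_list_eq_sum_nth)
      have "card P \<le> (\<Sum>i<k. l ! i)"
        unfolding ind[symmetric] by (rule sum_mono) (use l(2) in \<open>auto simp: Suc_le_eq\<close>)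
      then show False
        using False l(1) by simp
    qed
    then have "positive_compositions k r P = {}"
      by blast
    moreover have "r + k - 1 - card P < k - 1"
      using False k cP by simp
    ultimately show ?thesis
      by (simp add: binomial_eq_0)
  qed
qed

text \<open>
  Inclusion and exclusion over the blocks on which a composition is positive throughout.
\<close>

lemma card_compositions_with_zeros:
  assumes I: "I \<subseteq> {..<k}" and J: "J \<subseteq> {..<k}" and IJ: "I \<inter> J = {}" and k: "2 \<le> k"
  shows "int (card {l. length l = k \<and> sum_list l = r \<and> (\<exists>i\<in>I. l ! i = 0) \<and> (\<exists>i\<in>J. l ! i = 0)}) =
    int ((r + k - 1) choose (k - 1))
    - int ((r + k - 1 - card I) choose (k - 1)) - int ((r + k - 1 - card J) choose (k - 1))
    + int ((r + k - 1 - (card I + card J)) choose (k - 1))"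
proof -
  let ?W = "positive_compositions k r"
  have "{l. length l = k \<and> sum_list l = r \<and> (\<exists>i\<in>I. l ! i = 0) \<and> (\<exists>i\<in>J. l ! i = 0)}
      = ?W {} - (?W I \<union> ?W J)"
    by (auto simp: positive_compositions_def)
  moreover have "?W I \<union> ?W J \<subseteq> ?W {}"
    by (auto simp: positive_compositions_def)
  ultimately have "int (card {l. length l = k \<and> sum_list l = r \<and> (\<exists>i\<in>I. l ! i = 0) \<and> (\<exists>i\<in>J. l ! i = 0)})
      = int (card (?W {})) - int (card (?W I \<union> ?W J))"
    by (simp add: card_Diff_subset of_nat_diff card_mono)
  moreover have "card (?W I) + card (?W J) = card (?W I \<union> ?W J) + card (?W (I \<union> J))"
    unfolding positive_compositions_Un by (rule card_Un_Int) simp_all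
  moreover have "card (I \<union> J) = card I + card J"
    using I J IJ by (meson card_Un_disjoint finite_lessThan finite_subset)
  ultimately show ?thesis
    using card_positive_compositions[of "{}" k r] card_positive_compositions[OF I k, of r]
      card_positive_compositions[OF J k, of r] card_positive_compositions[of "I \<union> J" k r] I J k
    by simp
qed

section \<open>Semi-magic squares as normalised compositions\<close>

text \<open>
  The difference and the sum of \<open>j\<close> and \<open>i\<close> have the same parity, and reduction modulo an even
  number preserves it. Conversely, \<open>u\<close> and \<open>v\<close> of equal parity are attained at
  \<open>j = (u + v) div 2\<close>, which is already below \<open>n\<close>, and \<open>i\<close> congruent to \<open>j - u\<close>.
\<close>

lemma residues_diff_sum_iff:
  assumes "even n"
  shows "(\<forall>j<n. \<forall>i<n. Q (nat ((int j - int i) mod int n)) (nat ((int j + int i) mod int n)))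
    \<longleftrightarrow> (\<forall>u<n. \<forall>v<n. even (u + v) \<longrightarrow> Q u v)" (is "?L \<longleftrightarrow> ?R")
proof
  assume L: ?L
  show ?R
  proof (intro allI impI)
    fix u v assume uv: "u < n" "v < n" "even (u + v)"
    then obtain j where j: "u + v = 2 * j" by (elim evenE)
    define i where "i = nat ((int j - int u) mod int n)"
    have i: "int i = (int j - int u) mod int n" and "i < n" "j < n"
      using uv j by (auto simp: i_def nat_less_iff)
    have "(int j - int i) mod int n = (int j - (int j - int u)) mod int n"
      by (rule mod_diff_cong) (simp_all add: i)
    moreover have "(int j + int i) mod int n = (int j + (int j - int u)) mod int n"
      by (rule mod_add_cong) (simp_all add: i)
    moreover have "int j + (int j - int u) = int v" using j by simp
    ultimately have "nat ((int j - int i) mod int n) = u" "nat ((int j + int i) mod int n) = v"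
      using uv by simp_all
    then show "Q u v"
      using L \<open>i < n\<close> \<open>j < n\<close> by blast
  qed
next
  assume R: ?R
  show ?L
  proof (intro allI impI)
    fix j i assume "j < n" "i < n"
    then have n: "0 < int n" by simp
    let ?u = "nat ((int j - int i) mod int n)" and ?v = "nat ((int j + int i) mod int n)"
    have uv: "int ?u = (int j - int i) mod int n" "int ?v = (int j + int i) mod int n"
      using n by simp_all
    have "even (int ?u) = even (int j - int i)" "even (int ?v) = even (int j + int i)"
      using assms unfolding uv by (simp_all add: dvd_mod_iff)
    then have "even (?u + ?v)" by (simp del: int_nat_eq)
    moreover have "?u < n" "?v < n"
      using n by (simp_all add: nat_less_iff)
    ultimately show "Q ?u ?v" using R by blast
  qed
qed

text \<open>
  Differences of values of \<open>b\<close> are differences of entries of the table \<open>a u + b v\<close>, hence integers.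
  Let \<open>v0\<close> minimise \<open>b\<close>, that is, minimise some row of the table. Moving the constant \<open>b v0\<close> from
  \<open>b\<close> to \<open>a\<close> makes \<open>b\<close> non-negative with a zero at \<open>v0\<close>, and \<open>a\<close> becomes the column of \<open>v0\<close>.
\<close>

lemma nonneg_additive_normal_form:
  fixes a b :: "'i \<Rightarrow> complex"
  assumes fin: "finite S" and ne: "S \<noteq> {}" and nat: "\<And>u v. u \<in> S \<Longrightarrow> v \<in> S \<Longrightarrow> a u + b v \<in> \<nat>"
  obtains a' b' :: "'i \<Rightarrow> nat"
  where "\<And>u v. u \<in> S \<Longrightarrow> v \<in> S \<Longrightarrow> a u + b v = of_nat (a' u + b' v)" and "\<exists>v\<in>S. b' v = 0"
proof -
  define X where "X u v = (SOME k. a u + b v = of_nat k)" for u v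
  have X: "a u + b v = of_nat (X u v)" if "u \<in> S" "v \<in> S" for u v
    unfolding X_def by (rule someI_ex) (use nat[OF that] in \<open>auto elim: Nats_cases\<close>)
  obtain u0 where u0: "u0 \<in> S"
    using ne by blast
  obtain v0 where v0: "v0 \<in> S" "\<And>v. v \<in> S \<Longrightarrow> X u0 v0 \<le> X u0 v"
    using arg_min_if_finite[OF fin ne, of "X u0"] by (metis not_le)
  show ?thesis
  proof
    fix u v assume uv: "u \<in> S" "v \<in> S"
    have "of_nat (X u v0 + (X u0 v - X u0 v0)) = (a u + b v0) + ((a u0 + b v) - (a u0 + b v0))"
      unfolding X[OF uv(1) v0(1)] X[OF u0 uv(2)] X[OF u0 v0(1)] of_nat_add
        of_nat_diff[OF v0(2)[OF uv(2)]] ..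
    also have "\<dots> = a u + b v"
      by simp
    finally show "a u + b v = of_nat (X u v0 + (X u0 v - X u0 v0))" ..
  next
    show "\<exists>v\<in>S. X u0 v - X u0 v0 = 0"
      using v0 by auto
  qed
qed

text \<open>
  The first \<open>n\<close> entries of the list are the values of \<open>a\<close> on the residues, the last \<open>n\<close> those of \<open>b\<close>.
\<close>

definition square_of_list :: "nat \<Rightarrow> nat list \<Rightarrow> complex mat" where
  "square_of_list n l = toeplitz_hankel n
     (\<lambda>x. of_nat (l ! nat (x mod int n))) (\<lambda>x. of_nat (l ! (n + nat (x mod int n))))"

text \<open>
  The values of \<open>b\<close> have minimum zero separately on the even and on the odd residues, since a constant
  may be moved between \<open>a\<close> and \<open>b\<close> in each parity class independently.
\<close>

definition normalised_lists :: "nat \<Rightarrow> nat \<Rightarrow> nat list set" where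
  "normalised_lists n r = {l. length l = 2 * n \<and> sum_list l = r
     \<and> (\<exists>i\<in>(+) n ` {v. v < n \<and> even v}. l ! i = 0)
     \<and> (\<exists>i\<in>(+) n ` {v. v < n \<and> odd v}. l ! i = 0)}"

lemma square_of_list_entry:
  "j < n \<Longrightarrow> i < n \<Longrightarrow> square_of_list n l $$ (j, i) =
     of_nat (l ! nat ((int j - int i) mod int n) + l ! (n + nat ((int j + int i) mod int n)))"
  by (simp add: square_of_list_def toeplitz_hankel_def)

lemma semi_magic_square_of_list:
  assumes l: "length l = 2 * n" and n: "1 \<le> n"
  shows "semi_magic n s (square_of_list n l) \<longleftrightarrow> of_nat (sum_list l) = s"
proof -
  have "sum_list l = sum_list (take n l) + sum_list (drop n l)"
    by (simp flip: sum_list_append)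
  also have "\<dots> = (\<Sum>k<n. l ! k) + (\<Sum>k<n. l ! (n + k))"
    using l by (simp add: sum_list_sum_nth atLeast0LessThan)
  finally have "of_nat (sum_list l) = (\<Sum>k<n. of_nat (l ! k)) + (\<Sum>k<n. of_nat (l ! (n + k)) :: complex)"
    by simp
  moreover have "periodic n (\<lambda>x. of_nat (l ! nat (x mod int n)) :: complex)"
    "periodic n (\<lambda>x. of_nat (l ! (n + nat (x mod int n))) :: complex)"
    unfolding periodic_def by simp_all
  ultimately show ?thesis
    unfolding square_of_list_def by (simp add: semi_magic_toeplitz_hankel_iff[OF _ _ n])
qed

lemma square_of_list_semi_magic_square:
  assumes l: "length l = 2 * n" and n: "1 \<le> n"
  shows "square_of_list n l \<in> toeplitz_hankel_space n"
    and "semi_magic_square n (of_nat (sum_list l)) (square_of_list n l)"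
proof -
  show "square_of_list n l \<in> toeplitz_hankel_space n"
    unfolding square_of_list_def by (rule toeplitz_hankel_spaceI) (simp_all add: periodic_def)
  show "semi_magic_square n (of_nat (sum_list l)) (square_of_list n l)"
    unfolding semi_magic_square_def
    by (simp add: semi_magic_square_of_list[OF l n] square_of_list_entry del: of_nat_add)
qed

lemma normalised_zero:
  assumes "l \<in> normalised_lists n r"
  shows "\<exists>v<n. even (u + v) \<and> l ! (n + v) = 0"
  using assms unfolding normalised_lists_def by (cases "even u") auto

text \<open>
  A zero of \<open>b\<close> exhibits the value \<open>a u\<close> as an entry of the table, and in every representation with
  natural \<open>b\<close> all entries of row \<open>u\<close> are at least \<open>a u\<close>. Hence \<open>a u\<close> is the minimum of row \<open>u\<close> and is
  determined by the matrix; then so is \<open>b\<close>.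
\<close>

lemma inj_on_square_of_list:
  assumes n: "even n"
  shows "inj_on (square_of_list n) (normalised_lists n r)"
proof (rule inj_onI)
  fix l l'
  assume l: "l \<in> normalised_lists n r" and l': "l' \<in> normalised_lists n r"
    and eq: "square_of_list n l = square_of_list n l'"
  let ?Q = "\<lambda>u v. l ! u + l ! (n + v) = l' ! u + l' ! (n + v)"
  have "\<forall>j<n. \<forall>i<n. ?Q (nat ((int j - int i) mod int n)) (nat ((int j + int i) mod int n))"
  proof (intro allI impI)
    fix j i assume "j < n" "i < n"
    then show "?Q (nat ((int j - int i) mod int n)) (nat ((int j + int i) mod int n))"
      using arg_cong[OF eq, of "\<lambda>A. A $$ (j, i)"]
      by (simp only: square_of_list_entry of_nat_eq_iff)
  qed
  then have Q: "?Q u v" if "u < n" "v < n" "even (u + v)" for u v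
    using that unfolding residues_diff_sum_iff[OF n, where Q = ?Q] by blast
  have fst_half: "l ! u = l' ! u" if "u < n" for u
  proof -
    obtain v v' where "v < n" "even (u + v)" "l ! (n + v) = 0"
      and "v' < n" "even (u + v')" "l' ! (n + v') = 0"
      using normalised_zero[OF l, of u] normalised_zero[OF l', of u] by blast
    then show ?thesis
      using Q[of u v] Q[of u v'] that by simp
  qed
  have snd_half: "l ! (n + v) = l' ! (n + v)" if "v < n" for v
    using Q[of v v] fst_half[of v] that by simp
  show "l = l'"
  proof (rule nth_equalityI)
    show "length l = length l'"
      using l l' by (simp add: normalised_lists_def)
    fix i assume "i < length l"
    then have "i < 2 * n"
      using l by (simp add: normalised_lists_def)
    then show "l ! i = l' ! i"
      using fst_half[of i] snd_half[of "i - n"] by (cases "i < n") auto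
  qed
qed

text \<open>
  The complex functions \<open>a\<close> and \<open>b\<close> are normalised on each parity class, and the results are merged into
  one list.
\<close>

lemma square_of_normalised_list_exists:
  assumes n: "even n" "2 \<le> n"
    and A: "A \<in> toeplitz_hankel_space n" and sq: "semi_magic_square n (of_nat r) A"
  obtains l where "l \<in> normalised_lists n r" and "A = square_of_list n l"
proof -
  obtain a b where a: "periodic n a" and b: "periodic n b" and A: "A = toeplitz_hankel n a b"
    using A by (rule toeplitz_hankel_spaceE)
  have res: "a (int j - int i) = a (int (nat ((int j - int i) mod int n)))"
    "b (int j + int i) = b (int (nat ((int j + int i) mod int n)))" if "j < n" for j i
    using that by (auto intro!: periodicD[OF a] periodicD[OF b])
  let ?Q = "\<lambda>u v. a (int u) + b (int v) \<in> \<nat>"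
  have "\<forall>j<n. \<forall>i<n. ?Q (nat ((int j - int i) mod int n)) (nat ((int j + int i) mod int n))"
  proof (intro allI impI)
    fix j i assume ji: "j < n" "i < n"
    then have "A $$ (j, i) = a (int j - int i) + b (int j + int i)"
      by (simp add: A toeplitz_hankel_def)
    then show "?Q (nat ((int j - int i) mod int n)) (nat ((int j + int i) mod int n))"
      using sq ji unfolding semi_magic_square_def res[OF ji(1), symmetric] by metis
  qed
  then have nat: "?Q u v" if "u < n" "v < n" "even (u + v)" for u v
    using that unfolding residues_diff_sum_iff[OF n(1), where Q = ?Q] by blast
  let ?E = "{v. v < n \<and> even v}" and ?O = "{v. v < n \<and> odd v}"
  have "0 \<in> ?E" "1 \<in> ?O"
    using n by auto
  then have ne: "?E \<noteq> {}" "?O \<noteq> {}"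
    by blast+
  obtain a0 b0 :: "nat \<Rightarrow> nat"
    where E: "\<And>u v. u \<in> ?E \<Longrightarrow> v \<in> ?E \<Longrightarrow> a (int u) + b (int v) = of_nat (a0 u + b0 v)"
      and E0: "\<exists>v\<in>?E. b0 v = 0"
    by (rule nonneg_additive_normal_form[of ?E "\<lambda>u. a (int u)" "\<lambda>v. b (int v)"]) (use ne nat in auto)
  obtain a1 b1 :: "nat \<Rightarrow> nat"
    where O: "\<And>u v. u \<in> ?O \<Longrightarrow> v \<in> ?O \<Longrightarrow> a (int u) + b (int v) = of_nat (a1 u + b1 v)"
      and O0: "\<exists>v\<in>?O. b1 v = 0"
    by (rule nonneg_additive_normal_form[of ?O "\<lambda>u. a (int u)" "\<lambda>v. b (int v)"]) (use ne nat in auto)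
  define l where "l = map (\<lambda>u. if even u then a0 u else a1 u) [0..<n]
    @ map (\<lambda>v. if even v then b0 v else b1 v) [0..<n]"
  have len: "length l = 2 * n"
    by (simp add: l_def)
  have fst_half: "l ! u = (if even u then a0 u else a1 u)" if "u < n" for u
    using that by (simp add: l_def nth_append)
  have snd_half: "l ! (n + v) = (if even v then b0 v else b1 v)" if "v < n" for v
    using that by (simp add: l_def nth_append)
  let ?R = "\<lambda>u v. a (int u) + b (int v) = of_nat (l ! u + l ! (n + v))"
  have "?R u v" if "u < n" "v < n" "even (u + v)" for u v
    using that E[of u v] O[of u v] by (cases "even u") (simp_all add: fst_half snd_half)
  then have R: "\<forall>j<n. \<forall>i<n. ?R (nat ((int j - int i) mod int n)) (nat ((int j + int i) mod int n))"
    unfolding residues_diff_sum_iff[OF n(1), where Q = ?R] by blast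
  have A_eq: "A = square_of_list n l"
  proof (rule eq_matI)
    fix j i assume "j < dim_row (square_of_list n l)" "i < dim_col (square_of_list n l)"
    then have ji: "j < n" "i < n"
      by (simp_all add: square_of_list_def toeplitz_hankel_def)
    have "A $$ (j, i) = a (int j - int i) + b (int j + int i)"
      using ji by (simp add: A toeplitz_hankel_def)
    also have "\<dots> = square_of_list n l $$ (j, i)"
      unfolding res[OF ji(1)] square_of_list_entry[OF ji] using R ji by blast
    finally show "A $$ (j, i) = square_of_list n l $$ (j, i)" .
  qed (simp_all add: A square_of_list_def toeplitz_hankel_def)
  have "sum_list l = r"
    using sq n(2) unfolding A_eq semi_magic_square_def
    by (simp add: semi_magic_square_of_list[OF len])
  moreover have "\<exists>i\<in>(+) n ` ?E. l ! i = 0"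
    using E0 by (auto simp: snd_half)
  moreover have "\<exists>i\<in>(+) n ` ?O. l ! i = 0"
    using O0 by (auto simp: snd_half)
  ultimately have "l \<in> normalised_lists n r"
    using len by (simp add: normalised_lists_def)
  then show ?thesis
    using A_eq that by blast
qed

lemma H_count_dihedral_eq_card:
  assumes n: "even n" "2 \<le> n"
  shows "H_count n (dihedral n) r = card (normalised_lists n r)"
proof -
  let ?S = "{A \<in> toeplitz_hankel_space n. semi_magic_square n (of_nat r) A}"
  have "square_of_list n ` normalised_lists n r = ?S"
  proof (intro subset_antisym subsetI)
    fix A assume "A \<in> square_of_list n ` normalised_lists n r"
    then obtain l where l: "l \<in> normalised_lists n r" and A: "A = square_of_list n l"
      by blast
    then have "length l = 2 * n" "sum_list l = r"
      by (simp_all add: normalised_lists_def)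
    then show "A \<in> ?S"
      using square_of_list_semi_magic_square[of l n] n(2) unfolding A by simp
  next
    fix A assume "A \<in> ?S"
    then show "A \<in> square_of_list n ` normalised_lists n r"
      using square_of_normalised_list_exists[OF n, of A r] by blast
  qed
  then have "card ?S = card (normalised_lists n r)"
    using card_image[OF inj_on_square_of_list[OF n(1)], of r] by simp
  then show ?thesis
    using n(2) by (simp add: H_count_def MM_dihedral)
qed

section \<open>The counting formula and its generating function\<close>

lemma card_parity_class:
  "card ((+) n ` {v. v < 2 * m \<and> even v}) = m"
  "card ((+) n ` {v. v < 2 * m \<and> odd v}) = m"
proof -
  have "{v. v < 2 * m \<and> even v} = (\<lambda>i. 2 * i) ` {..<m}"
    by (auto elim!: evenE)
  then have "card {v. v < 2 * m \<and> even v} = m"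
    by (simp add: card_image inj_on_def)
  then show "card ((+) n ` {v. v < 2 * m \<and> even v}) = m"
    by (simp add: card_image)
  have "{v. v < 2 * m \<and> odd v} = (\<lambda>i. 2 * i + 1) ` {..<m}"
    by (auto elim!: oddE)
  then have "card {v. v < 2 * m \<and> odd v} = m"
    by (simp add: card_image inj_on_def)
  then show "card ((+) n ` {v. v < 2 * m \<and> odd v}) = m"
    by (simp add: card_image)
qed

lemma H_count_dihedral:
  assumes m: "1 \<le> m" and n: "n = 2 * m"
  shows "int (H_count n (dihedral n) r) =
    int ((r + 4 * m - 1) choose (2 * n - 1))
    - 2 * int ((r + 3 * m - 1) choose (2 * n - 1))
    + int ((r + 2 * m - 1) choose (2 * n - 1))"
proof -
  let ?I = "(+) n ` {v. v < n \<and> even v}" and ?J = "(+) n ` {v. v < n \<and> odd v}"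
  have count: "int (card (normalised_lists n r)) =
      int ((r + 2 * n - 1) choose (2 * n - 1))
      - int ((r + 2 * n - 1 - card ?I) choose (2 * n - 1))
      - int ((r + 2 * n - 1 - card ?J) choose (2 * n - 1))
      + int ((r + 2 * n - 1 - (card ?I + card ?J)) choose (2 * n - 1))"
    unfolding normalised_lists_def
    by (rule card_compositions_with_zeros) (use m n in auto)
  have card_IJ: "card ?I = m" "card ?J = m"
    unfolding n by (rule card_parity_class)+
  have tops: "r + 2 * n - 1 = r + 4 * m - 1" "r + 4 * m - 1 - m = r + 3 * m - 1"
    "r + 4 * m - 1 - (m + m) = r + 2 * m - 1"
    using m n by simp_all
  have "H_count n (dihedral n) r = card (normalised_lists n r)"
    using m n by (intro H_count_dihedral_eq_card) simp_all
  then show ?thesis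
    using count unfolding card_IJ tops by simp
qed

text \<open>
  Expanding \<open>(1 - x\<^sup>m)\<^sup>2 = 1 - 2 x\<^sup>m + x\<^sup>2\<^sup>m\<close> shifts the negative binomial series by \<open>0\<close>, \<open>m\<close> and
  \<open>2 * m\<close>. Below the shift the coefficient is zero, and so is the binomial coefficient, because its
  upper argument is smaller than \<open>2 * n - 1\<close>.
\<close>

lemma fps_nth_square_over_power:
  assumes n: "1 \<le> n" and m: "m \<le> n"
  shows "fps_nth ((1 - fps_X ^ m) ^ 2 / (1 - fps_X) ^ (2 * n) :: rat fps) r =
     of_int (int ((r + 2 * n - 1) choose (2 * n - 1))
       - 2 * int ((r + 2 * n - 1 - m) choose (2 * n - 1))
       + int ((r + 2 * n - 1 - 2 * m) choose (2 * n - 1)))"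
proof -
  define G :: "rat fps" where "G = Abs_fps (\<lambda>k. of_nat ((2 * n + k - 1) choose k))"
  have G: "inverse ((1 - fps_X) ^ (2 * n)) = G"
    using one_minus_const_fps_X_neg_power'[of "2 * n" "1 :: rat"] n by (simp add: G_def)
  have square: "(1 - Y) ^ 2 * Z = Z - (Y * Z + Y * Z) + Y * Y * Z" for Y Z :: "rat fps"
    by (simp add: power2_eq_square left_diff_distrib right_diff_distrib distrib_right mult.assoc)
  have "(1 - fps_X ^ m) ^ 2 / (1 - fps_X) ^ (2 * n) = (1 - fps_X ^ m) ^ 2 * G"
    unfolding G[symmetric] by (rule fps_divide_unit) (simp add: fps_power_zeroth)
  also have "\<dots> = G - (fps_X ^ m * G + fps_X ^ m * G) + fps_X ^ (2 * m) * G"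
    unfolding square by (simp only: mult_2 power_add)
  finally have "fps_nth ((1 - fps_X ^ m) ^ 2 / (1 - fps_X) ^ (2 * n) :: rat fps) r =
     fps_nth G r - 2 * (if r < m then 0 else fps_nth G (r - m)) + (if r < 2 * m then 0 else fps_nth G (r - 2 * m))"
    by (simp only: fps_add_nth fps_sub_nth fps_X_power_mult_nth mult_2)
  moreover have "(if r < d then 0 else fps_nth G (r - d)) = of_nat ((r + 2 * n - 1 - d) choose (2 * n - 1))"
    if "d \<le> 2 * n" for d
  proof (cases "r < d")
    case True
    then have "r + 2 * n - 1 - d < 2 * n - 1"
      using that n by linarith
    then show ?thesis
      using True by (simp add: binomial_eq_0)
  next
    case False
    have "(2 * n + (r - d) - 1) choose (r - d) = (r + 2 * n - 1 - d) choose (2 * n - 1)"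
      using False n by (subst binomial_symmetric) (auto simp: algebra_simps)
    then show ?thesis using False by (simp add: G_def)
  qed
  from this[of 0] this[of m] this[of "2 * m"] have
    "fps_nth G r = of_nat ((r + 2 * n - 1) choose (2 * n - 1))"
    "(if r < m then 0 else fps_nth G (r - m)) = of_nat ((r + 2 * n - 1 - m) choose (2 * n - 1))"
    "(if r < 2 * m then 0 else fps_nth G (r - 2 * m)) = of_nat ((r + 2 * n - 1 - 2 * m) choose (2 * n - 1))"
    using m by simp_all
  ultimately show ?thesis by simp
qed

theorem theorem2:
  fixes m n :: nat
  assumes "m \<ge> 2" and "n = 2 * m"
  shows "(\<forall>r::nat. int (H_count n (dihedral n) r) =
            int ((r + 4 * m - 1) choose (2 * n - 1))
            - 2 * int ((r + 3 * m - 1) choose (2 * n - 1))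
            + int ((r + 2 * m - 1) choose (2 * n - 1)))
       \<and> (Abs_fps (\<lambda>r. of_nat (H_count n (dihedral n) r)) :: rat fps) =
            (1 - fps_X ^ m) ^ 2 / (1 - fps_X) ^ (2 * n)"
proof -
  have H: "int (H_count n (dihedral n) r) =
      int ((r + 4 * m - 1) choose (2 * n - 1))
      - 2 * int ((r + 3 * m - 1) choose (2 * n - 1))
      + int ((r + 2 * m - 1) choose (2 * n - 1))" for r
    using assms by (intro H_count_dihedral) simp_all
  have "(Abs_fps (\<lambda>r. of_nat (H_count n (dihedral n) r)) :: rat fps) =
      (1 - fps_X ^ m) ^ 2 / (1 - fps_X) ^ (2 * n)"
  proof (rule fps_ext)
    fix r
    have "r + 2 * n - 1 = r + 4 * m - 1" "r + 2 * n - 1 - m = r + 3 * m - 1"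
      "r + 2 * n - 1 - 2 * m = r + 2 * m - 1"
      using assms by simp_all
    then have "fps_nth ((1 - fps_X ^ m) ^ 2 / (1 - fps_X) ^ (2 * n) :: rat fps) r =
        of_int (int (H_count n (dihedral n) r))"
      using fps_nth_square_over_power[of n m r] assms unfolding H by simp
    then show "fps_nth (Abs_fps (\<lambda>r. of_nat (H_count n (dihedral n) r)) :: rat fps) r =
        fps_nth ((1 - fps_X ^ m) ^ 2 / (1 - fps_X) ^ (2 * n)) r"
      by simp
  qed
  with H show ?thesis
    by blast
qed

end
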